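(* Let $0<\epsilon<1/2$ and $k\in\mathbb{N}$. For all sufficiently large $m$ (depending on $\epsilon$ and $k$), the following holds for the budget of uncertainty set $$\mathcal{U}=\Big\{h\in\mathbb{R}^m_+:\sum_{i=1}^mh_i=\sqrt m,\ 0\le h_i\le1\ \forall i\in\{1,\dots,m\}\Big\}.$$ If $P(m)\le m^k$ is a positive integer, then for any $z_1,z_2,\dots,z_{P(m)}\in\mathcal{U}$ the set $$\hat{\mathcal{U}}=m^{\frac12-\epsilon}\cdot\mathrm{conv}\big(z_1,z_2,\dots,z_{P(m)}\big)$$ does not dominate $\mathcal{U}$.
   Context: $\mathrm{conv}$ denotes convex hull. A set $\hat{\mathcal{U}}\subseteq\mathbb{R}^m_+$ dominates $\mathcal{U}\subseteq\mathbb{R}^m_+$ if for every $h\in\mathcal{U}$ there is $\hat h\in\hat{\mathcal{U}}$ with $\hat h\ge h$ componentwise. *)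

theory Defs
  imports "HOL-Analysis.Analysis" "HOL-Analysis.Finite_Function_Topology"
begin

text \<open>
  The dimension \<open>m\<close> is quantified inside the theorem, so \<open>\<real>\<^sup>m\<close> cannot be \<open>real ^ 'n\<close>. It is taken
  to be the subspace of the library's real vector space \<open>nat \<Rightarrow>\<^sub>0 real\<close> of those vectors whose
  coordinates vanish outside \<open>{1..m}\<close>. Vector space operations and the library's convex hull
  restrict to the usual ones on this subspace.
\<close>

definition nonneg_orthant :: "nat \<Rightarrow> (nat \<Rightarrow>\<^sub>0 real) set" where
  "nonneg_orthant m =
     {h. Poly_Mapping.keys h \<subseteq> {1..m} \<and> (\<forall>i\<in>{1..m}. 0 \<le> Poly_Mapping.lookup h i)}"

definition budget_set :: "nat \<Rightarrow> (nat \<Rightarrow>\<^sub>0 real) set" where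
  "budget_set m =
     {h \<in> nonneg_orthant m.
        (\<Sum>i=1..m. Poly_Mapping.lookup h i) = sqrt (real m) \<and>
        (\<forall>i\<in>{1..m}. 0 \<le> Poly_Mapping.lookup h i \<and> Poly_Mapping.lookup h i \<le> 1)}"

text \<open>Intended for \<open>V, U \<subseteq> nonneg_orthant m\<close>.\<close>

definition dominates :: "nat \<Rightarrow> (nat \<Rightarrow>\<^sub>0 real) set \<Rightarrow> (nat \<Rightarrow>\<^sub>0 real) set \<Rightarrow> bool" where
  "dominates m V U \<longleftrightarrow>
     (\<forall>h\<in>U. \<exists>h'\<in>V. \<forall>i\<in>{1..m}. Poly_Mapping.lookup h i \<le> Poly_Mapping.lookup h' i)"

end

theory Submission
  imports Defs "HOL-Real_Asymp.Real_Asymp"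
begin

text \<open>
  Put \<open>s = \<lfloor>\<surd>m\<rfloor>\<close>, split \<open>s\<^sup>2 \<le> m\<close> of the coordinates into \<open>s\<close> blocks of size \<open>s\<close>, and pick one
  coordinate from each block uniformly and independently. A point \<open>z\<close> of the budget set then has
  expected mass at most \<open>\<surd>m / s \<le> 2\<close> on the chosen set \<open>S\<close>, and by a Chernoff bound its mass exceeds
  \<open>T\<close> with probability at most \<open>exp (2 - T / 2)\<close>. For \<open>T = s / m powr (1 / 2 - \<epsilon>)\<close>, which is at least
  \<open>m powr \<epsilon> / 2\<close>, a union bound over \<open>m ^ k\<close> points leaves some \<open>S\<close> on which every \<open>z j\<close>, hence every
  point of the convex hull, has mass less than \<open>T\<close>. After scaling this is less than \<open>s\<close>, the mass on
  \<open>S\<close> of any point of the budget set that equals 1 on \<open>S\<close>.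
\<close>

text \<open>At rate 1/2 the quadratic remainder \<open>(x / 2)\<^sup>2\<close> is at most
  \<open>x / 2\<close> on the unit interval, so a bound linear in \<open>x\<close> survives; this
  fixes the rate in the Chernoff bound.\<close>

lemma exp_half_le_one_plus:
  fixes x :: real
  assumes "0 \<le> x" "x \<le> 1"
  shows "exp (x / 2) \<le> 1 + x"
proof -
  have "exp (x / 2) \<le> 1 + x / 2 + (x / 2)\<^sup>2"
    using assms by (intro exp_bound) auto
  also have "(x / 2)\<^sup>2 \<le> x / 2"
    using mult_left_le [of "x / 2" "x / 2"] assms by (simp add: power2_eq_square)
  finally show ?thesis by simp
qed

text \<open>Exponential moment of the selected mass, multiplied by the number \<open>s ^ s\<close>
  of selections. Independence of the blocks appears as the factorization of a sum over choice
  functions into a product; \<open>W / s\<close> bounds the expected mass.\<close>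

lemma sum_PiE_exp_half_le:
  fixes w :: "nat \<Rightarrow> nat \<Rightarrow> real"
  assumes "0 < s"
    and "\<And>b c. b < s \<Longrightarrow> c < s \<Longrightarrow> 0 \<le> w b c \<and> w b c \<le> 1"
    and "(\<Sum>b<s. \<Sum>c<s. w b c) \<le> W"
  shows "(\<Sum>f\<in>{..<s} \<rightarrow>\<^sub>E {..<s}. exp ((\<Sum>b<s. w b (f b)) / 2)) \<le> real s ^ s * exp (W / s)"
proof -
  have "(\<Sum>f\<in>{..<s} \<rightarrow>\<^sub>E {..<s}. exp ((\<Sum>b<s. w b (f b)) / 2))
      = (\<Sum>f\<in>{..<s} \<rightarrow>\<^sub>E {..<s}. \<Prod>b<s. exp (w b (f b) / 2))"
    by (simp add: exp_sum sum_divide_distrib)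
  also have "\<dots> = (\<Prod>b<s. \<Sum>c<s. exp (w b c / 2))"
    by (rule prod_sum_PiE [symmetric]) auto
  also have "\<dots> \<le> (\<Prod>b<s. real s * exp ((\<Sum>c<s. w b c) / s))"
  proof (intro prod_mono conjI sum_nonneg)
    fix b assume "b \<in> {..<s}"
    then have "(\<Sum>c<s. exp (w b c / 2)) \<le> (\<Sum>c<s. 1 + w b c)"
      using assms(2) by (intro sum_mono exp_half_le_one_plus) auto
    also have "\<dots> = real s * (1 + (\<Sum>c<s. w b c) / s)"
      using assms(1) by (simp add: sum.distrib field_simps)
    \<comment> \<open>The exponential form makes the product over blocks depend only on the total
      mass, not on its distribution among the blocks.\<close>
    also have "\<dots> \<le> real s * exp ((\<Sum>c<s. w b c) / s)"
      by (intro mult_left_mono exp_ge_add_one_self) auto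
    finally show "(\<Sum>c<s. exp (w b c / 2)) \<le> real s * exp ((\<Sum>c<s. w b c) / s)" .
  qed auto
  also have "\<dots> = real s ^ s * exp ((\<Sum>b<s. \<Sum>c<s. w b c) / s)"
    by (simp add: prod.distrib exp_sum sum_divide_distrib)
  also have "\<dots> \<le> real s ^ s * exp (W / s)"
    using assms(3) by (intro mult_left_mono) (auto simp: divide_right_mono)
  finally show ?thesis .
qed

text \<open>Union bound by averaging: add the exponential moments over \<open>J\<close> and take a
  selection where this total is at most its average. All summands are positive, so each one obeys
  the same bound.\<close>

lemma exists_light_selection:
  fixes w :: "'j \<Rightarrow> nat \<Rightarrow> nat \<Rightarrow> real"
  assumes "finite J" "0 < s"
    and "\<And>j b c. j \<in> J \<Longrightarrow> b < s \<Longrightarrow> c < s \<Longrightarrow> 0 \<le> w j b c \<and> w j b c \<le> 1"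
    and "\<And>j. j \<in> J \<Longrightarrow> (\<Sum>b<s. \<Sum>c<s. w j b c) \<le> W"
  obtains f where "\<And>b. b < s \<Longrightarrow> f b < s"
    and "\<And>j. j \<in> J \<Longrightarrow> exp ((\<Sum>b<s. w j b (f b)) / 2) \<le> real (card J) * exp (W / s)"
proof -
  let ?F = "{..<s} \<rightarrow>\<^sub>E {..<s}"
  let ?e = "\<lambda>j f. exp ((\<Sum>b<s. w j b (f b)) / 2)"
  have fin: "finite ?F" and card: "real (card ?F) = real s ^ s"
    by (auto intro: finite_PiE simp: card_PiE)
  have ne: "?F \<noteq> {}"
    using assms(2) by (auto simp: PiE_eq_empty_iff)
  have "(\<Sum>f\<in>?F. \<Sum>j\<in>J. ?e j f) = (\<Sum>j\<in>J. \<Sum>f\<in>?F. ?e j f)"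
    by (rule sum.swap)
  also have "\<dots> \<le> (\<Sum>j\<in>J. real s ^ s * exp (W / s))"
    using assms by (intro sum_mono sum_PiE_exp_half_le) auto
  also have "\<dots> = (\<Sum>f\<in>?F. real (card J) * exp (W / s))"
    using card by simp
  finally have le: "(\<Sum>f\<in>?F. \<Sum>j\<in>J. ?e j f) \<le> (\<Sum>f\<in>?F. real (card J) * exp (W / s))" .
  have "\<exists>f\<in>?F. (\<Sum>j\<in>J. ?e j f) \<le> real (card J) * exp (W / s)"
  proof (rule ccontr)
    assume "\<not> ?thesis"
    then have "(\<Sum>f\<in>?F. real (card J) * exp (W / s)) < (\<Sum>f\<in>?F. \<Sum>j\<in>J. ?e j f)"
      by (intro sum_strict_mono [OF fin ne]) (simp add: not_le)
    with le show False by simp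
  qed
  then obtain f where f: "f \<in> ?F" "(\<Sum>j\<in>J. ?e j f) \<le> real (card J) * exp (W / s)"
    by blast
  show thesis
  proof
    show "f b < s" if "b < s" for b
      using f(1) that by (auto simp: PiE_iff)
    show "?e j f \<le> real (card J) * exp (W / s)" if "j \<in> J" for j
      using member_le_sum [of j J "\<lambda>j. ?e j f"] that assms(1) f(2) by auto
  qed
qed

lemma budget_set_ge_one_on:
  assumes "S \<subseteq> {1..m}" "real (card S) \<le> sqrt m" "sqrt m \<le> m" "card S < m"
  obtains h where "h \<in> budget_set m" "\<And>i. i \<in> S \<Longrightarrow> Poly_Mapping.lookup h i = 1"
proof -
  \<comment> \<open>The mass left over from \<open>S\<close> is spread evenly over the other
    coordinates.\<close>
  define c where "c = (sqrt m - card S) / (real m - card S)"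
  have c: "0 \<le> c" "c \<le> 1"
    using assms by (auto simp: c_def divide_simps)
  define g where "g i = (if i \<in> S then 1 else if i \<in> {1..m} then c else 0)" for i
  define h where "h = Abs_poly_mapping g"
  have "finite {i. g i \<noteq> 0}"
    by (rule finite_subset [of _ "{1..m}"]) (use assms(1) in \<open>auto simp: g_def split: if_splits\<close>)
  then have h: "Poly_Mapping.lookup h = g"
    by (simp add: h_def)
  have fS: "finite S"
    using assms(1) finite_subset by blast
  have "(\<Sum>i=1..m. g i) = (\<Sum>i\<in>{1..m} - S. g i) + (\<Sum>i\<in>S. g i)"
    by (rule sum.subset_diff) (use assms in auto)
  also have "\<dots> = (\<Sum>i\<in>{1..m} - S. c) + (\<Sum>i\<in>S. 1)"
    by (intro arg_cong2 [of _ _ _ _ "(+)"] sum.cong) (auto simp: g_def)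
  also have "\<dots> = (real m - card S) * c + card S"
    using assms fS by (simp add: card_Diff_subset)
  also have "\<dots> = sqrt m"
    using assms by (simp add: c_def)
  finally have "h \<in> budget_set m"
    using c assms(1)
    by (auto simp: budget_set_def nonneg_orthant_def h g_def in_keys_iff split: if_splits)
  moreover have "Poly_Mapping.lookup h i = 1" if "i \<in> S" for i
    using that by (simp add: h g_def)
  ultimately show thesis
    using that by blast
qed

lemma lookup_scaleR:
  fixes x :: "'a \<Rightarrow>\<^sub>0 real"
  shows "Poly_Mapping.lookup (r *\<^sub>R x) i = r * Poly_Mapping.lookup x i"
proof -
  have "finite {i. r * Poly_Mapping.lookup x i \<noteq> 0}"
    by (rule finite_subset [OF _ finite_lookup [of x]]) auto
  then show ?thesis
    by (simp add: scaleR_poly_mapping_def)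
qed

text \<open>The mass on \<open>S\<close> is a linear functional, so its strict sublevel set is
  convex and contains the hull once it contains the generators.\<close>

lemma lookup_sum_less_convex_hull:
  fixes Z :: "('a \<Rightarrow>\<^sub>0 real) set"
  assumes "\<And>z. z \<in> Z \<Longrightarrow> (\<Sum>i\<in>S. Poly_Mapping.lookup z i) < T" "x \<in> convex hull Z"
  shows "(\<Sum>i\<in>S. Poly_Mapping.lookup x i) < T"
proof -
  let ?\<phi> = "\<lambda>x::'a \<Rightarrow>\<^sub>0 real. \<Sum>i\<in>S. Poly_Mapping.lookup x i"
  have "linear ?\<phi>"
    by (rule linearI)
      (simp_all add: lookup_add lookup_scaleR sum.distrib sum_distrib_left)
  then have "convex (?\<phi> -` {..<T})"
    by (rule convex_linear_vimage) auto
  then have "convex hull Z \<subseteq> ?\<phi> -` {..<T}"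
    using assms(1) by (intro hull_minimal) auto
  then show ?thesis
    using assms(2) by auto
qed

lemma block_index_le:
  fixes b c s :: nat
  assumes "b < s" "c < s"
  shows "b * s + c < s * s"
proof -
  have "b * s + c < (b + 1) * s"
    using assms by simp
  also have "\<dots> \<le> s * s"
    using assms by (intro mult_right_mono) auto
  finally show ?thesis .
qed

text \<open>\<open>b\<close> and \<open>c\<close> are quotient and remainder modulo
  \<open>s\<close>, hence recoverable from the index.\<close>

lemma block_index_inj:
  "inj_on (\<lambda>(b, c). b * s + c + 1) ({..<s} \<times> {..<s :: nat})"
proof (rule inj_onI, clarify)
  fix b c b' c' :: nat
  assume *: "b < s" "c < s" "b' < s" "c' < s" "b * s + c + 1 = b' * s + c' + 1"
  then have "(b * s + c) div s = (b' * s + c') div s" "(b * s + c) mod s = (b' * s + c') mod s"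
    by auto
  moreover have "(b * s + c) div s = b" "(b' * s + c') div s = b'"
    using * by (simp_all only: div_mult_self3 div_less add_0_right)
  moreover have "(b * s + c) mod s = c" "(b' * s + c') mod s = c'"
    using * by (simp_all only: mod_mult_self3 mod_less)
  ultimately show "b = b' \<and> c = c'" by simp
qed

lemma not_dominates_budget_set:
  fixes z :: "nat \<Rightarrow> (nat \<Rightarrow>\<^sub>0 real)" and m s :: nat and \<alpha> :: real
  assumes s: "2 \<le> s" "real s \<le> sqrt m" "sqrt m \<le> 2 * real s"
    and \<alpha>: "0 < \<alpha>"
    and J: "finite J" "real (card J) * exp 2 < exp (s / \<alpha> / 2)"
    and z: "\<And>j. j \<in> J \<Longrightarrow> z j \<in> budget_set m"
  shows "\<not> dominates m ((\<lambda>x. \<alpha> *\<^sub>R x) ` (convex hull (z ` J))) (budget_set m)"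
proof
  assume dom: "dominates m ((\<lambda>x. \<alpha> *\<^sub>R x) ` (convex hull (z ` J))) (budget_set m)"
  let ?l = Poly_Mapping.lookup
  have ssm: "s * s \<le> m"
  proof -
    have "real s * real s \<le> sqrt m * sqrt m"
      using s by (intro mult_mono) auto
    then show ?thesis
      by (simp flip: of_nat_mult)
  qed
  have "2 * s \<le> s * s"
    using s(1) by (intro mult_right_mono) auto
  with ssm s(1) have sm: "s < m" by linarith
  have "sqrt m \<le> sqrt (real m * real m)"
    using sm by (intro real_sqrt_le_mono) (simp flip: of_nat_mult)
  then have sqm: "sqrt m \<le> m" by simp
  \<comment> \<open>Block \<open>b\<close> consists of the coordinates \<open>b * s + 1\<close> to
    \<open>b * s + s\<close>; the shift by 1 matches \<open>{1..m}\<close>.\<close>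
  define w where "w j b c = ?l (z j) (b * s + c + 1)" for j b c
  have ran: "b * s + c + 1 \<in> {1..m}" if "b < s" "c < s" for b c
    using block_index_le [OF that] ssm by auto
  have w01: "0 \<le> w j b c \<and> w j b c \<le> 1" if "j \<in> J" "b < s" "c < s" for j b c
    using z [OF that(1)] ran [OF that(2,3)] unfolding budget_set_def w_def by blast
  have wsum: "(\<Sum>b<s. \<Sum>c<s. w j b c) \<le> sqrt m" if "j \<in> J" for j
  proof -
    have "(\<Sum>b<s. \<Sum>c<s. w j b c) = (\<Sum>p\<in>{..<s} \<times> {..<s}. ?l (z j) ((\<lambda>(b, c). b * s + c + 1) p))"
      by (simp add: sum.cartesian_product w_def case_prod_unfold)
    also have "\<dots> = (\<Sum>i\<in>(\<lambda>(b, c). b * s + c + 1) ` ({..<s} \<times> {..<s}). ?l (z j) i)"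
      by (simp only: sum.reindex [OF block_index_inj] o_def)
    \<comment> \<open>Coordinates outside the blocks are nonnegative, so including them can only
      increase the sum.\<close>
    also have "\<dots> \<le> (\<Sum>i=1..m. ?l (z j) i)"
      using z [OF that] ran by (intro sum_mono2) (auto simp: budget_set_def)
    finally show ?thesis
      using z [OF that] by (simp add: budget_set_def)
  qed
  obtain f where f: "\<And>b. b < s \<Longrightarrow> f b < s"
    and fw: "\<And>j. j \<in> J \<Longrightarrow> exp ((\<Sum>b<s. w j b (f b)) / 2) \<le> real (card J) * exp (sqrt m / s)"
    using exists_light_selection [of J s w "sqrt m"] J(1) s(1) w01 wsum by auto
  define S where "S = (\<lambda>b. b * s + f b + 1) ` {..<s}"
  have inj: "inj_on (\<lambda>b. b * s + f b + 1) {..<s}"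
  proof (rule inj_onI)
    fix b b' assume "b \<in> {..<s}" "b' \<in> {..<s}" "b * s + f b + 1 = b' * s + f b' + 1"
    then show "b = b'"
      using inj_onD [OF block_index_inj, of s "(b, f b)" "(b', f b')"] f by simp
  qed
  have S: "S \<subseteq> {1..m}" "card S = s"
    using ran f inj by (auto simp: S_def card_image)
  have light: "(\<Sum>i\<in>S. ?l (z j) i) < s / \<alpha>" if "j \<in> J" for j
  proof -
    have "exp ((\<Sum>i\<in>S. ?l (z j) i) / 2) \<le> real (card J) * exp (sqrt m / s)"
      using fw [OF that] by (simp only: S_def sum.reindex [OF inj] w_def o_def)
    \<comment> \<open>Here \<open>sqrt m \<le> 2 * real s\<close> bounds the expected mass by
      2.\<close>
    also have "\<dots> \<le> real (card J) * exp 2"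
      using s by (intro mult_left_mono) (auto simp: field_simps)
    also note J(2)
    finally show ?thesis by simp
  qed
  obtain h where h: "h \<in> budget_set m" "\<And>i. i \<in> S \<Longrightarrow> ?l h i = 1"
    using budget_set_ge_one_on [of S m] S s sm sqm by auto
  then obtain x where x: "x \<in> convex hull (z ` J)" "\<And>i. i \<in> {1..m} \<Longrightarrow> ?l h i \<le> ?l (\<alpha> *\<^sub>R x) i"
    using dom unfolding dominates_def by blast
  have "(\<Sum>i\<in>S. ?l h i) \<le> (\<Sum>i\<in>S. ?l (\<alpha> *\<^sub>R x) i)"
    using x(2) S(1) by (intro sum_mono) auto
  then have "real s \<le> \<alpha> * (\<Sum>i\<in>S. ?l x i)"
    using h(2) S by (simp add: lookup_scaleR sum_distrib_left)
  also have "\<dots> < \<alpha> * (s / \<alpha>)"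
  proof (rule mult_strict_left_mono [OF _ \<alpha>])
    show "(\<Sum>i\<in>S. ?l x i) < s / \<alpha>"
      using light by (intro lookup_sum_less_convex_hull [OF _ x(1)]) blast
  qed
  finally show False
    using \<alpha> by simp
qed

theorem theorem5p1:
  fixes \<epsilon> :: real and k :: nat
  assumes "0 < \<epsilon>" and "\<epsilon> < 1 / 2"
  shows "\<forall>\<^sub>F m :: nat in sequentially.
           \<forall>P :: nat. 1 \<le> P \<and> P \<le> m ^ k \<longrightarrow>
             (\<forall>z :: nat \<Rightarrow> (nat \<Rightarrow>\<^sub>0 real). (\<forall>j\<in>{1..P}. z j \<in> budget_set m) \<longrightarrow>
               \<not> dominates m
                   ((\<lambda>x. (real m powr (1 / 2 - \<epsilon>)) *\<^sub>R x) ` (convex hull (z ` {1..P})))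
                   (budget_set m))"
proof -
  \<comment> \<open>The 4 combines the rate 1/2 with the lower bound
    \<open>real m powr \<epsilon> / 2\<close> for the threshold.\<close>
  have "\<forall>\<^sub>F m :: nat in sequentially. real m ^ k * exp 2 < exp (real m powr \<epsilon> / 4)"
    using assms(1) by real_asymp
  then show ?thesis
    using eventually_ge_at_top [of 4]
  proof (eventually_elim, intro allI impI)
    fix m P :: nat and z :: "nat \<Rightarrow> (nat \<Rightarrow>\<^sub>0 real)"
    assume m: "real m ^ k * exp 2 < exp (real m powr \<epsilon> / 4)" "4 \<le> m"
      and P: "1 \<le> P \<and> P \<le> m ^ k" and z: "\<forall>j\<in>{1..P}. z j \<in> budget_set m"
    let ?\<alpha> = "real m powr (1 / 2 - \<epsilon>)"
    define s where "s = nat \<lfloor>sqrt m\<rfloor>"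
    \<comment> \<open>From \<open>4 \<le> m\<close> the floor \<open>s\<close> is at least 2, and
      then \<open>sqrt m < s + 1 \<le> 2 * s\<close>.\<close>
    have "sqrt 4 \<le> sqrt (real m)"
      using m(2) by (intro real_sqrt_le_mono) auto
    then have "2 \<le> sqrt m" by simp
    then have s: "2 \<le> s" "real s \<le> sqrt m" "sqrt m \<le> 2 * real s"
      unfolding s_def by linarith+
    have "real m powr \<epsilon> * ?\<alpha> = sqrt m"
      using m(2) by (simp add: powr_half_sqrt flip: powr_add)
    with s(3) m(2) have T: "real m powr \<epsilon> / 2 \<le> s / ?\<alpha>"
      by (simp add: field_simps)
    have "real P \<le> real m ^ k"
      using P by (metis of_nat_le_iff of_nat_power)
    then have "real P * exp 2 \<le> real m ^ k * exp 2" by simp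
    moreover have "exp (real m powr \<epsilon> / 4) \<le> exp (s / ?\<alpha> / 2)"
      using divide_right_mono [OF T, of 2] by simp
    ultimately have "real (card {1..P}) * exp 2 < exp (s / ?\<alpha> / 2)"
      using m(1) unfolding card_atLeastAtMost diff_Suc_1 by linarith
    then show "\<not> dominates m ((\<lambda>x. ?\<alpha> *\<^sub>R x) ` (convex hull (z ` {1..P}))) (budget_set m)"
      using s z m(2) by (intro not_dominates_budget_set [of s]) auto
  qed
qed

end
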